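(* Let $d\geq 1$, $h>0$ and $u\in H^r((h\mathbb{Z})^d)$ for some $r\in\mathbb{R}$. Let $s\in(0,1)$ and assume that for some $R\ge h$, $$u=0=(-\Delta_{\mathrm d})^s u \quad\text{in } (h\mathbb{Z})^d\setminus B_R .$$ Then $u\equiv 0$ in $(h\mathbb{Z})^d$.
   Context: Here $(h\mathbb{Z})^d=\{hj: j\in\mathbb{Z}^d\}$, $u_j:=u(hj)$, and $B_R=\{x\in(h\mathbb{Z})^d: |x|<R\}$ with $|\cdot|$ the Euclidean norm. For $s\in(0,1)$ the fractional discrete Laplacian is $$(-\Delta_{\mathrm d})^s u_j=\sum_{m\in\mathbb{Z}^d,\,m\ne j}(u_j-u_m)K_s^h(j-m),\qquad K_s^h(m)=\frac{1}{h^{2s}|\Gamma(-s)|}\int_0^\infty e^{-2dt}\prod_{i=1}^d I_{m_i}(2t)\,\frac{dt}{t^{1+s}}\quad (m\neq 0),$$ with $K_s^h(0)=0$, where $I_k$ is the modified Bessel function of the first kind of order $k\in\mathbb{Z}$ (so $I_{-k}=I_k$). The Fourier transform of $u:(h\mathbb{Z})^d\to\mathbb{R}$ is $\mathcal{F}u(\xi)=\sum_{k\in\mathbb{Z}^d}u_k e^{-ih\xi\cdot k}$, $\xi\in[-\pi/h,\pi/h)^d$. For $r\in\mathbb{R}$, $\|u\|_{H^r((h\mathbb{Z})^d)}:=\big\|\mathcal{F}^{-1}\big[(1+h^{-2}\sum_{k=1}^d|\sin(h\xi_k)|^2)^{r/2}\mathcal{F}u\big]\big\|_{L^2((h\mathbb{Z})^d)}$,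 and $H^r((h\mathbb{Z})^d)$ is the closure of the finitely supported functions on $(h\mathbb{Z})^d$ with respect to this norm. *)

theory Defs
  imports "HOL-Analysis.Analysis"
begin

text \<open>
  A function \<open>u\<close> on the lattice \<open>(h\<int>)^d\<close> is represented by \<open>j \<mapsto> u_j = u(h j)\<close>, i.e. by a function
  on the index group \<open>\<int>^d\<close>, which is the type \<^typ>\<open>int ^ 'd\<close> with \<open>d = CARD('d)\<close>.
  The map \<open>lattice_pt h\<close> sends the index \<open>j\<close> to the lattice point \<open>h j\<close>.
\<close>

definition lattice_pt :: "real \<Rightarrow> int ^ 'd \<Rightarrow> real ^ 'd" where
  "lattice_pt h j = (\<chi> i. h * real_of_int (j $ i))"

definition lattice_ball :: "real \<Rightarrow> real \<Rightarrow> (int ^ 'd) set" where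
  "lattice_ball h R = {j. norm (lattice_pt h j) < R}"

definition bessel_I :: "int \<Rightarrow> real \<Rightarrow> real" where
  "bessel_I k x =
    (\<Sum>n. (x / 2) ^ (2 * n + nat \<bar>k\<bar>) / (fact n * fact (n + nat \<bar>k\<bar>)))"

definition frac_kernel :: "real \<Rightarrow> real \<Rightarrow> int ^ 'd \<Rightarrow> real" where
  "frac_kernel h s m =
    (if m = 0 then 0
     else 1 / (h powr (2 * s) * \<bar>Gamma (- s)\<bar>) *
       (LINT t:{0<..}|lborel.
          exp (- 2 * real CARD('d) * t) * (\<Prod>i\<in>UNIV. bessel_I (m $ i) (2 * t)) / t powr (1 + s)))"

definition frac_laplacian :: "real \<Rightarrow> real \<Rightarrow> (int ^ 'd \<Rightarrow> real) \<Rightarrow> int ^ 'd \<Rightarrow> real" where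
  "frac_laplacian h s u j = (\<Sum>\<^sub>\<infinity>m\<in>UNIV - {j}. (u j - u m) * frac_kernel h s (j - m))"

definition freq_cell :: "real \<Rightarrow> (real ^ 'd) set" where
  "freq_cell h = {\<xi>. \<forall>i. - pi / h \<le> \<xi> $ i \<and> \<xi> $ i < pi / h}"

text \<open>In both transforms below \<open>\<xi> \<bullet> lattice_pt h k\<close> is the phase \<open>h \<xi> \<cdot> k\<close>.\<close>

definition lattice_fourier :: "real \<Rightarrow> (int ^ 'd \<Rightarrow> real) \<Rightarrow> real ^ 'd \<Rightarrow> complex" where
  "lattice_fourier h u \<xi> = (\<Sum>\<^sub>\<infinity>k. of_real (u k) * cis (- (\<xi> \<bullet> lattice_pt h k)))"

definition lattice_inv_fourier :: "real \<Rightarrow> (real ^ 'd \<Rightarrow> complex) \<Rightarrow> int ^ 'd \<Rightarrow> complex" where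
  "lattice_inv_fourier h g k =
    of_real ((h / (2 * pi)) ^ CARD('d)) *
      (LINT \<xi>:freq_cell h|lborel. g \<xi> * cis (\<xi> \<bullet> lattice_pt h k))"

text \<open>
  The lattice carries the mesh measure giving each point mass \<open>h^d\<close>. A different
  normalisation only rescales the norms by a constant and does not affect the spaces.
\<close>

definition lattice_L2_norm :: "real \<Rightarrow> (int ^ 'd \<Rightarrow> complex) \<Rightarrow> real" where
  "lattice_L2_norm h f = sqrt (h ^ CARD('d) * (\<Sum>\<^sub>\<infinity>j. (norm (f j))\<^sup>2))"

definition Hr_norm :: "real \<Rightarrow> real \<Rightarrow> (int ^ 'd \<Rightarrow> real) \<Rightarrow> real" where
  "Hr_norm h r u = lattice_L2_norm h (lattice_inv_fourier h
    (\<lambda>\<xi>. of_real ((1 + (\<Sum>k\<in>UNIV. \<bar>sin (h * \<xi> $ k)\<bar>\<^sup>2) / h\<^sup>2) powr (r / 2)) * lattice_fourier h u \<xi>))"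

text \<open>
  The space \<open>H^r\<close> is the closure (completion) of the finitely supported functions in \<open>Hr_norm\<close>.
  The series defining the Fourier transform need not converge pointwise for a general element of the
  closure, so \<open>Hr_norm\<close> is only evaluated on finitely supported functions: an element of
  the closure is the limit of an \<open>Hr_norm\<close>-Cauchy sequence of such functions. The
  norm controls each point value, so the limit is the pointwise one.
\<close>

definition finitely_supported :: "(int ^ 'd \<Rightarrow> real) \<Rightarrow> bool" where
  "finitely_supported v \<longleftrightarrow> finite {j. v j \<noteq> 0}"

definition Hr_space :: "real \<Rightarrow> real \<Rightarrow> (int ^ 'd \<Rightarrow> real) set" where
  "Hr_space h r = {u. \<exists>v :: nat \<Rightarrow> int ^ 'd \<Rightarrow> real.
     (\<forall>n. finitely_supported (v n)) \<and>
     (\<forall>\<epsilon>>0. \<exists>N. \<forall>m\<ge>N. \<forall>n\<ge>N. Hr_norm h r (\<lambda>j. v m j - v n j) < \<epsilon>) \<and>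
     (\<forall>j. (\<lambda>n. v n j) \<longlonglongrightarrow> u j)}"

end

theory Submission
  imports Defs "HOL-Computational_Algebra.Polynomial"
begin

text \<open>
  Write \<open>f = (-\<Delta>)\<^sup>s u\<close>. Balls of the lattice are finite, so both \<open>u\<close> and \<open>f\<close> are finitely supported
  and their Fourier transforms are trigonometric polynomials. The operator is a Fourier multiplier:
  its symbol is a positive constant times \<open>\<lambda>\<^sup>s\<close>, where \<open>\<lambda> = \<Sum>\<^sub>i \<bar>1 - w\<^sub>i\<bar>\<^sup>2\<close> is the symbol of the discrete
  Laplacian at the point \<open>w\<close> of the torus. The identity \<open>F f = C \<lambda>\<^sup>s F u\<close> between two trigonometric
  polynomials is impossible for non-integer \<open>s\<close> unless \<open>u = 0\<close>, because near \<open>w = (1, \<dots>, 1)\<close> the factor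
  \<open>\<lambda>\<^sup>s\<close> vanishes like \<open>\<bar>\<theta>\<bar>\<^bsup>2s\<^esup>\<close>, which is not the behaviour of a quotient of polynomials.

  The symbol (\<open>frac_kernel_fourier\<close>) is computed from the heat kernel
  \<open>G\<^sub>t(m) = e\<^bsup>-2dt\<^esup> \<Prod>\<^sub>i I\<^bsub>m\<^sub>i\<^esub>(2t)\<close>. The generating function of the Bessel functions gives
  \<open>\<Sum>\<^sub>m G\<^sub>t(m) \<chi>\<^sub>w(m) = e\<^bsup>-t\<lambda>\<^esup>\<close> for the character \<open>\<chi>\<^sub>w\<close> (\<open>heat_kernel_fourier\<close>). Summing the kernel
  against \<open>1 - Re \<chi>\<^sub>w \<ge> 0\<close> and exchanging sum and integral, which is legitimate as everything is
  nonnegative, leaves \<open>\<integral> (1 - e\<^bsup>-t\<lambda>\<^esup>) t\<^bsup>-1-s\<^esup> dt\<close>, and this is \<open>\<lambda>\<^sup>s\<close> times its value at \<open>\<lambda> = 1\<close> by scaling.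

  In several variables the identity is restricted to a curve \<open>w\<^sub>i = z\<^bsup>a\<^sub>i\<^esup>\<close> with \<open>\<bar>z\<bar> = 1\<close>. If the
  positive integers \<open>a\<^sub>i\<close> are chosen so that \<open>j \<mapsto> a \<sqdot> j\<close> is injective on the ball
  (\<open>ex_separating_direction\<close>), no information about \<open>u\<close> is lost, and after multiplication by a power of
  \<open>z\<close> one has two polynomials in one variable with \<open>Q(z) = C (\<bar>z - 1\<bar>\<^sup>2 L(z))\<^sup>s P(z)\<close> on the unit circle,
  where \<open>L\<close> is continuous with \<open>L(1) > 0\<close>. Comparing the orders \<open>k\<close> of \<open>P\<close> and \<open>l\<close> of \<open>Q\<close> at \<open>z = 1\<close> gives
  \<open>l = k + 2s\<close>, so \<open>s = 1/2\<close> is the only remaining case. It is excluded because \<open>(z - 1) / \<bar>z - 1\<bar>\<close> would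
  then have one limit as \<open>z \<rightarrow> 1\<close> on the circle, whereas it tends to \<open>\<i>\<close> from one side and to \<open>-\<i>\<close> from the
  other (\<open>fractional_power_not_rational\<close>).
\<close>

section \<open>A fractional power of the symbol is not rational\<close>

text \<open>
  The weight \<open>\<bar>z - 1\<bar>\<^sup>2 L z\<close> has a double zero at \<open>1\<close>, so its \<open>s\<close>-th power vanishes there to the order \<open>2s\<close>,
  strictly between \<open>0\<close> and \<open>2\<close>. Moduli alone rule out every \<open>s \<noteq> 1/2\<close>; for \<open>s = 1/2\<close> the arguments have to
  be compared.
\<close>
lemma fractional_power_not_rational:
  fixes P Q :: "complex poly" and L :: "complex \<Rightarrow> real"
  assumes "0 < s" "s < 1" "P \<noteq> 0" "C > 0" "isCont L 1" "L 1 > 0"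
    and eq: "\<And>z. norm z = 1 \<Longrightarrow> z \<noteq> 1 \<Longrightarrow> L z > 0 \<Longrightarrow>
      poly Q z = of_real (C * ((norm (z - 1))\<^sup>2 * L z) powr s) * poly P z"
  shows False
proof -
  \<comment> \<open>A sequence on the unit circle that tends to \<open>1\<close> from one side; its conjugates approach from the other.\<close>
  define \<zeta> where "\<zeta> n = cis (1 / real (Suc n))" for n
  have norm_\<zeta>: "norm (\<zeta> n) = 1" for n by (simp add: \<zeta>_def)
  have inv_0: "(\<lambda>n. 1 / real (Suc n)) \<longlonglongrightarrow> 0"
    using LIMSEQ_inverse_real_of_nat by (simp add: inverse_eq_divide)
  have inv_le_1: "1 / real (Suc n) \<le> 1" and inv_pos: "0 < 1 / real (Suc n)" for n
    by simp_all
  have \<zeta>_lim: "\<zeta> \<longlonglongrightarrow> 1"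
    unfolding \<zeta>_def using tendsto_cis[OF inv_0] by simp
  have \<zeta>_ne: "\<zeta> n \<noteq> 1" for n
  proof
    assume "\<zeta> n = 1"
    then have "sin (1 / real (Suc n)) = 0" by (simp add: \<zeta>_def complex_eq_iff)
    moreover have "1 / real (Suc n) < pi"
      using inv_le_1[of n] pi_gt3 by linarith
    moreover have "0 < 1 / real (Suc n)" by simp
    ultimately show False using sin_gt_zero[of "1 / real (Suc n)"] by linarith
  qed
  define x where "x n = norm (\<zeta> n - 1)" for n
  have x_pos: "x n > 0" for n using \<zeta>_ne by (simp add: x_def)
  have x_lim: "x \<longlonglongrightarrow> 0"
    unfolding x_def using tendsto_norm[OF tendsto_diff[OF \<zeta>_lim tendsto_const[of 1]]] by simp
  have "inj \<zeta>"
  proof (rule injI)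
    fix m n assume "\<zeta> m = \<zeta> n"
    then have eq: "sin (1 / real (Suc m)) = sin (1 / real (Suc n))" by (simp add: \<zeta>_def complex_eq_iff)
    have range: "- (pi/2) \<le> 1 / real (Suc k)" "1 / real (Suc k) \<le> pi/2" for k
      using inv_le_1[of k] inv_pos[of k] pi_gt3 by linarith+
    have "1 / real (Suc m) = 1 / real (Suc n)"
      by (rule sin_inj_pi [OF range range eq])
    then show "m = n" by simp
  qed
  have L_ev: "eventually (\<lambda>n. L (\<zeta> n) > 0) sequentially"
    using isCont_tendsto_compose[OF \<open>isCont L 1\<close> \<zeta>_lim] \<open>L 1 > 0\<close> order_tendstoD(1) by blast
  have "Q \<noteq> 0"
  proof
    assume "Q = 0"
    have "eventually (\<lambda>n. poly P (\<zeta> n) = 0) sequentially"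
      using L_ev
    proof eventually_elim
      case (elim n)
      then show ?case
        using eq[OF norm_\<zeta> \<zeta>_ne elim] \<open>Q = 0\<close> \<open>C > 0\<close> x_pos[of n] by (simp add: x_def)
    qed
    then obtain N where "\<And>n. n \<ge> N \<Longrightarrow> poly P (\<zeta> n) = 0"
      by (auto simp: eventually_sequentially)
    then have "\<zeta> ` {N..} \<subseteq> {z. poly P z = 0}" by auto
    moreover have "infinite (\<zeta> ` {N..})"
      using \<open>inj \<zeta>\<close> by (simp add: finite_image_iff inj_on_subset infinite_Ici)
    ultimately show False
      using poly_roots_finite[OF \<open>P \<noteq> 0\<close>] finite_subset by blast
  qed
  obtain P' where P': "P = [:- 1, 1:] ^ order 1 P * P'" "\<not> [:- 1, 1:] dvd P'"
    using order_decomp[OF \<open>P \<noteq> 0\<close>, of 1] by blast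
  obtain Q' where Q': "Q = [:- 1, 1:] ^ order 1 Q * Q'" "\<not> [:- 1, 1:] dvd Q'"
    using order_decomp[OF \<open>Q \<noteq> 0\<close>, of 1] by blast
  define k l where "k = order 1 P" and "l = order 1 Q"
  have P: "poly P z = (z - 1) ^ k * poly P' z" for z
    by (subst P'(1)) (simp add: k_def)
  have Q: "poly Q z = (z - 1) ^ l * poly Q' z" for z
    by (subst Q'(1)) (simp add: l_def)
  have P1: "poly P' 1 \<noteq> 0" and Q1: "poly Q' 1 \<noteq> 0"
    using P'(2) Q'(2) by (auto simp: poly_eq_0_iff_dvd)
  \<comment> \<open>Cancelling the zeros at \<open>1\<close> shows that \<open>x n powr \<beta>\<close> has a finite nonzero limit, which forces \<open>\<beta> = 0\<close>.\<close>
  define \<beta> where "\<beta> = real l - real k - 2 * s"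
  define c where "c = C * L 1 powr s * norm (poly P' 1) / norm (poly Q' 1)"
  have "c > 0" using \<open>C > 0\<close> \<open>L 1 > 0\<close> P1 Q1 by (simp add: c_def)
  have poly_lim: "(\<lambda>n. poly R (\<zeta> n)) \<longlonglongrightarrow> poly R 1" for R :: "complex poly"
    by (intro isCont_tendsto_compose[OF _ \<zeta>_lim]) simp
  have L_lim: "(\<lambda>n. L (\<zeta> n) powr r) \<longlonglongrightarrow> L 1 powr r" for r
    using \<open>L 1 > 0\<close> by (intro tendsto_powr tendsto_const isCont_tendsto_compose[OF \<open>isCont L 1\<close> \<zeta>_lim]) auto
  have "(\<lambda>n. C * L (\<zeta> n) powr s * norm (poly P' (\<zeta> n)) / norm (poly Q' (\<zeta> n))) \<longlonglongrightarrow> c"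
    unfolding c_def using Q1 by (intro tendsto_intros poly_lim L_lim) auto
  moreover have "eventually (\<lambda>n. C * L (\<zeta> n) powr s * norm (poly P' (\<zeta> n)) / norm (poly Q' (\<zeta> n)) = x n powr \<beta>) sequentially"
    using L_ev tendsto_imp_eventually_ne[OF poly_lim Q1]
  proof eventually_elim
    case (elim n)
    have "norm (poly Q (\<zeta> n)) = C * ((x n)\<^sup>2 * L (\<zeta> n)) powr s * norm (poly P (\<zeta> n))"
      using \<open>C > 0\<close> by (subst eq[OF norm_\<zeta> \<zeta>_ne elim(1)]) (simp add: norm_mult x_def)
    then have "x n ^ l * norm (poly Q' (\<zeta> n)) = C * ((x n)\<^sup>2 powr s * L (\<zeta> n) powr s) * (x n ^ k * norm (poly P' (\<zeta> n)))"
      using elim by (simp add: P Q norm_mult norm_power powr_mult flip: x_def)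
    also have "(x n)\<^sup>2 powr s = x n powr (2 * s)"
      using x_pos[of n] by (simp flip: powr_numeral add: powr_powr)
    finally have "x n powr real l * norm (poly Q' (\<zeta> n)) =
       x n powr (2 * s) * x n powr real k * (C * L (\<zeta> n) powr s * norm (poly P' (\<zeta> n)))"
      using x_pos[of n] by (simp add: powr_realpow mult_ac)
    then show ?case
      using x_pos[of n] elim by (simp add: \<beta>_def powr_diff powr_add field_simps)
  qed
  ultimately have x_beta: "(\<lambda>n. x n powr \<beta>) \<longlonglongrightarrow> c"
    by (rule Lim_transform_eventually)
  have "\<beta> = 0"
  proof (rule ccontr)
    assume "\<beta> \<noteq> 0"
    have *: "(\<lambda>n. x n powr \<gamma>) \<longlonglongrightarrow> 0" if "\<gamma> > 0" for \<gamma>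
      using tendsto_zero_powrI[OF x_lim tendsto_const[of \<gamma>]] that x_pos by (auto simp: less_imp_le)
    have "(\<lambda>n. x n powr \<beta> * x n powr (- \<beta>)) \<longlonglongrightarrow> 0"
    proof (cases "\<beta> > 0")
      case True
      have "(\<lambda>n. x n powr \<beta>) \<longlonglongrightarrow> 0" using * True by auto
      then show ?thesis using LIMSEQ_unique[OF x_beta] \<open>c > 0\<close> by auto
    next
      case False
      then have "(\<lambda>n. x n powr (- \<beta>)) \<longlonglongrightarrow> 0" using * \<open>\<beta> \<noteq> 0\<close> by auto
      from tendsto_mult[OF x_beta this] show ?thesis by simp
    qed
    moreover have "x n powr \<beta> * x n powr (- \<beta>) = 1" for n
      using x_pos[of n] by (simp flip: powr_add)
    ultimately show False by (simp add: LIMSEQ_const_iff)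
  qed
  then have "real l = real k + 2 * s" by (simp add: \<beta>_def)
  with \<open>0 < s\<close> \<open>s < 1\<close> have "l = Suc k" by linarith
  with \<open>real l = real k + 2 * s\<close> have "s = 1 / 2" by simp
  \<comment> \<open>Now the direction \<open>\<sigma> z\<close> of \<open>z - 1\<close> extends continuously to \<open>1\<close>. Its limit \<open>\<omega>\<close> has modulus \<open>1\<close>, is real
    since the relation may be used at \<open>z\<close> and at \<open>cnj z\<close>, and is imaginary since the circle is
    tangent to the imaginary direction at \<open>1\<close>.\<close>
  define \<sigma> where "\<sigma> z = (z - 1) / of_real (norm (z - 1))" for z :: complex
  define \<omega> where "\<omega> = of_real (C * L 1 powr (1/2)) * poly P' 1 / poly Q' 1"
  have \<sigma>_lim: "(\<lambda>n. \<sigma> (z n)) \<longlonglongrightarrow> \<omega>"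
    if z: "z \<longlonglongrightarrow> 1" "\<And>n. norm (z n) = 1" "\<And>n. z n \<noteq> 1" for z
  proof (rule Lim_transform_eventually)
    have L: "(\<lambda>n. L (z n)) \<longlonglongrightarrow> L 1"
      by (rule isCont_tendsto_compose[OF \<open>isCont L 1\<close> z(1)])
    have R: "(\<lambda>n. poly R (z n)) \<longlonglongrightarrow> poly R 1" for R
      by (intro isCont_tendsto_compose[OF _ z(1)]) simp
    show "(\<lambda>n. of_real (C * L (z n) powr (1/2)) * poly P' (z n) / poly Q' (z n)) \<longlonglongrightarrow> \<omega>"
      unfolding \<omega>_def using Q1 \<open>L 1 > 0\<close> by (intro tendsto_intros L R) auto
    show "eventually (\<lambda>n. of_real (C * L (z n) powr (1/2)) * poly P' (z n) / poly Q' (z n) = \<sigma> (z n)) sequentially"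
      using order_tendstoD(1)[OF L \<open>L 1 > 0\<close>] tendsto_imp_eventually_ne[OF R Q1]
    proof eventually_elim
      case (elim n)
      have "((norm (z n - 1))\<^sup>2 * L (z n)) powr s = norm (z n - 1) * L (z n) powr (1/2)"
        using elim by (simp add: \<open>s = 1 / 2\<close> powr_mult powr_half_sqrt)
      with eq[OF z(2,3) elim(1)] have "(z n - 1) ^ k * ((z n - 1) * poly Q' (z n)) =
          (z n - 1) ^ k * (of_real (C * (norm (z n - 1) * L (z n) powr (1/2))) * poly P' (z n))"
        by (simp add: P Q \<open>l = Suc k\<close> mult_ac)
      then have "(z n - 1) * poly Q' (z n) = of_real (C * (norm (z n - 1) * L (z n) powr (1/2))) * poly P' (z n)"
        using z(3)[of n] by simp
      then show ?case
        using z(3)[of n] elim by (simp add: \<sigma>_def field_simps)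
    qed
  qed
  have \<sigma>1: "(\<lambda>n. \<sigma> (\<zeta> n)) \<longlonglongrightarrow> \<omega>"
    by (intro \<sigma>_lim \<zeta>_lim norm_\<zeta> \<zeta>_ne)
  have "(\<lambda>n. \<sigma> (cnj (\<zeta> n))) \<longlonglongrightarrow> \<omega>"
    using tendsto_cnj[OF \<zeta>_lim] norm_\<zeta> \<zeta>_ne by (intro \<sigma>_lim) (auto simp: complex_cnj_one_iff)
  moreover have "\<sigma> (cnj z) = cnj (\<sigma> z)" for z
  proof -
    have "cnj z - 1 = cnj (z - 1)" by simp
    then show ?thesis
      by (simp only: \<sigma>_def complex_mod_cnj complex_cnj_divide complex_cnj_complex_of_real)
  qed
  ultimately have "\<omega> = cnj \<omega>"
    using LIMSEQ_unique[OF tendsto_cnj[OF \<sigma>1]] by simp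
  have Re_\<sigma>: "Re (\<sigma> (\<zeta> n)) = - x n / 2" for n
  proof -
    have "(x n)\<^sup>2 = (Re (\<zeta> n) - 1)\<^sup>2 + (Im (\<zeta> n))\<^sup>2" by (simp add: x_def cmod_power2)
    also have "\<dots> = (Re (\<zeta> n))\<^sup>2 + (Im (\<zeta> n))\<^sup>2 + 1 - 2 * Re (\<zeta> n)" by (simp add: power2_eq_square algebra_simps)
    also have "(Re (\<zeta> n))\<^sup>2 + (Im (\<zeta> n))\<^sup>2 = 1" using norm_\<zeta>[of n] by (metis cmod_power2 one_power2)
    finally have "Re (\<zeta> n) - 1 = - x n * x n / 2" by (simp add: power2_eq_square)
    then show ?thesis using x_pos[of n] by (simp add: \<sigma>_def flip: x_def)
  qed
  have "Re \<omega> = 0"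
    using LIMSEQ_unique[OF tendsto_Re[OF \<sigma>1]] tendsto_divide[OF tendsto_minus[OF x_lim] tendsto_const[of 2]]
    by (simp add: Re_\<sigma>)
  moreover have "Im \<omega> = 0" using \<open>\<omega> = cnj \<omega>\<close> by (simp add: complex_eq_iff)
  moreover have "norm \<omega> = 1"
  proof -
    have "norm (\<sigma> (\<zeta> n)) = 1" for n using \<zeta>_ne[of n] by (simp add: \<sigma>_def norm_divide)
    with tendsto_norm[OF \<sigma>1] show ?thesis by (simp add: LIMSEQ_const_iff)
  qed
  ultimately show False by (simp add: complex_eq_iff cmod_def)
qed

section \<open>Infinite sums\<close>

lemma has_sum_diff:
  fixes f g :: "'a \<Rightarrow> 'b::real_normed_vector"
  assumes "(f has_sum a) A" "(g has_sum b) A"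
  shows "((\<lambda>x. f x - g x) has_sum a - b) A"
  using has_sum_add [OF assms(1), of "\<lambda>x. - g x" "- b"] assms(2) by (simp add: has_sum_uminus)

lemma has_sum_sum:
  fixes f :: "'i \<Rightarrow> 'a \<Rightarrow> 'b::topological_comm_monoid_add"
  assumes "\<And>i. i \<in> I \<Longrightarrow> (f i has_sum a i) A"
  shows "((\<lambda>x. \<Sum>i\<in>I. f i x) has_sum (\<Sum>i\<in>I. a i)) A"
  using assms by (induction I rule: infinite_finite_induct) (auto intro: has_sum_add)

lemma has_sum_mult_Times:
  fixes f :: "'a \<Rightarrow> complex" and g :: "'b \<Rightarrow> complex"
  assumes "(f has_sum a) A" "(g has_sum b) B" "countable A" "countable B"
  shows "((\<lambda>(x, y). f x * g y) has_sum a * b) (A \<times> B)"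
proof -
  have "Infinite_Set_Sum.abs_summable_on f A" "Infinite_Set_Sum.abs_summable_on g B"
    using assms(1,2) by (auto simp: abs_summable_equivalent [symmetric]
      summable_on_iff_abs_summable_on_complex [symmetric] intro: has_sum_imp_summable)
  then have "Infinite_Set_Sum.abs_summable_on (\<lambda>(x, y). f x * g y) (A \<times> B)"
    using assms(3,4) by (intro abs_summable_on_product)
  then have "(\<lambda>(x, y). f x * g y) summable_on A \<times> B"
    unfolding abs_summable_equivalent [symmetric] by (rule abs_summable_summable)
  moreover have "((\<lambda>y. f x * g y) has_sum f x * b) B" for x
    by (intro has_sum_cmult_right assms)
  moreover have "((\<lambda>x. f x * b) has_sum a * b) A"
    by (intro has_sum_cmult_left assms)
  ultimately show ?thesis
    by (intro has_sum_SigmaI[where g = "\<lambda>x. f x * b"]) auto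
qed

text \<open>Fubini for absolutely convergent series: a product of \<open>d\<close> series is one series over \<open>\<int>\<^sup>d\<close>.\<close>
lemma has_sum_prod_vec:
  fixes f :: "'d::finite \<Rightarrow> int \<Rightarrow> complex"
  assumes "\<And>i. (f i has_sum a i) UNIV"
  shows "((\<lambda>m :: int ^ 'd. \<Prod>i\<in>UNIV. f i (m $ i)) has_sum (\<Prod>i\<in>UNIV. a i)) UNIV"
proof -
  have f: "Infinite_Set_Sum.abs_summable_on (f i) UNIV" for i
    using assms[of i] by (auto simp: abs_summable_equivalent [symmetric]
      summable_on_iff_abs_summable_on_complex [symmetric] intro: has_sum_imp_summable)
  have "Infinite_Set_Sum.abs_summable_on (\<lambda>g. \<Prod>i\<in>UNIV. f i (g i)) (PiE UNIV (\<lambda>_. UNIV))"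
    using f by (intro abs_summable_on_prod_PiE) auto
  then have 1: "(\<lambda>g. \<Prod>i\<in>UNIV. f i (g i)) summable_on UNIV"
    and 2: "infsetsum (\<lambda>g. \<Prod>i\<in>UNIV. f i (g i)) UNIV = infsum (\<lambda>g. \<Prod>i\<in>UNIV. f i (g i)) UNIV"
    by (auto simp: abs_summable_equivalent [symmetric] intro: abs_summable_summable infsetsum_infsum)
  have "infsetsum (\<lambda>g. \<Prod>i\<in>UNIV. f i (g i)) (PiE UNIV (\<lambda>_. UNIV)) = (\<Prod>i\<in>UNIV. infsetsum (f i) UNIV)"
    using f by (intro infsetsum_prod_PiE) auto
  also have "\<dots> = (\<Prod>i\<in>UNIV. a i)"
    using f by (simp add: infsetsum_infsum infsumI[OF assms])
  finally have "((\<lambda>g. \<Prod>i\<in>UNIV. f i (g i)) has_sum (\<Prod>i\<in>UNIV. a i)) UNIV"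
    using 1 2 by (simp add: has_sum_iff)
  also have "?this \<longleftrightarrow> ?thesis"
    by (rule has_sum_reindex_bij_witness[where i = "vec_nth" and j = "vec_lambda"]) auto
  finally show ?thesis .
qed

text \<open>Translates between series and integrals over a counting measure, so that Tonelli's theorem applies.\<close>
lemma nn_integral_count_space_has_sum_iff:
  fixes f :: "'a \<Rightarrow> real"
  assumes "\<And>x. f x \<ge> 0" "S \<ge> 0"
  shows "(\<integral>\<^sup>+x. ennreal (f x) \<partial>count_space UNIV) = ennreal S \<longleftrightarrow> (f has_sum S) UNIV"
proof
  assume S: "(\<integral>\<^sup>+x. ennreal (f x) \<partial>count_space UNIV) = ennreal S"
  then have "Infinite_Set_Sum.abs_summable_on f UNIV"
    unfolding Infinite_Set_Sum.abs_summable_on_def using assms by (intro integrableI_nonneg) auto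
  moreover from this have "infsetsum f UNIV = S"
    using nn_integral_conv_infsetsum [of f UNIV] S assms by (simp add: infsetsum_nonneg)
  ultimately show "(f has_sum S) UNIV"
    by (metis abs_summable_equivalent abs_summable_summable has_sum_infsum infsetsum_infsum)
next
  assume S: "(f has_sum S) UNIV"
  then have "Infinite_Set_Sum.abs_summable_on f UNIV"
    using assms by (auto simp: abs_summable_equivalent [symmetric] intro: has_sum_imp_summable)
  then show "(\<integral>\<^sup>+x. ennreal (f x) \<partial>count_space UNIV) = ennreal S"
    using nn_integral_conv_infsetsum [of f UNIV] S assms by (simp add: infsetsum_infsum infsumI)
qed

section \<open>Characters of the lattice\<close>

text \<open>Frequencies are encoded by the points \<open>w i = exp (- \<i> h \<xi>\<^sub>i)\<close> of the unit circle; this makes the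
  restriction to a curve \<open>w i = z ^ a i\<close> purely algebraic.\<close>
definition lattice_character :: "('d \<Rightarrow> complex) \<Rightarrow> int ^ 'd \<Rightarrow> complex" where
  "lattice_character w m = (\<Prod>i\<in>UNIV. w i powi (m $ i))"

lemma inverse_unit_eq_cnj:
  fixes w :: complex
  assumes "norm w = 1"
  shows "inverse w = cnj w"
proof (rule inverse_unique)
  show "w * cnj w = 1" using assms by (simp add: complex_norm_square [symmetric])
qed

lemma norm_lattice_character:
  assumes "\<And>i. norm (w i) = 1"
  shows "norm (lattice_character w m) = 1"
  using assms by (simp add: lattice_character_def prod_norm [symmetric] norm_power_int)

lemma lattice_character_uminus:
  assumes "\<And>i. norm (w i) = 1"
  shows "lattice_character w (- m) = cnj (lattice_character w m)"
proof -
  have "inverse (w i) = cnj (w i)" for i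
    using assms [of i] by (rule inverse_unit_eq_cnj)
  then show ?thesis
    by (simp add: lattice_character_def power_int_minus power_int_inverse [symmetric])
qed

lemma lattice_character_add:
  assumes "\<And>i. norm (w i) = 1"
  shows "lattice_character w (m + n) = lattice_character w m * lattice_character w n"
proof -
  have "w i \<noteq> 0" for i using assms [of i] by auto
  then show ?thesis
    by (simp add: lattice_character_def power_int_add prod.distrib)
qed

section \<open>The heat kernel on the lattice\<close>

lemma has_sum_exp_series: "((\<lambda>n. x ^ n / fact n) has_sum exp x) UNIV" for x :: complex
proof -
  have "((\<lambda>n. x ^ n /\<^sub>R fact n) has_sum exp x) UNIV"
    using summable_norm_exp exp_converges by (rule norm_summable_imp_has_sum)
  then show ?thesis
    by (simp add: scaleR_conv_of_real field_simps)
qed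

lemma bessel_I_has_sum:
  "((\<lambda>n. t ^ (2 * n + nat \<bar>k\<bar>) / (fact n * fact (n + nat \<bar>k\<bar>))) has_sum bessel_I k (2 * t)) UNIV"
proof -
  define a where "a n = t ^ (2 * n + nat \<bar>k\<bar>) / (fact n * fact (n + nat \<bar>k\<bar>))" for n
  have "summable (\<lambda>n. norm (a n))"
  proof (rule summable_comparison_test')
    show "summable (\<lambda>n. \<bar>t\<bar> ^ nat \<bar>k\<bar> * (inverse (fact n) * (t\<^sup>2) ^ n))"
      by (intro summable_mult summable_exp)
    fix n :: nat
    have "\<bar>t ^ (2 * n + nat \<bar>k\<bar>)\<bar> = \<bar>t\<bar> ^ nat \<bar>k\<bar> * \<bar>t\<bar> ^ (2 * n)"
      by (simp add: power_abs power_add abs_mult)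
    also have "\<bar>t\<bar> ^ (2 * n) = (t\<^sup>2) ^ n"
      by (simp add: power_mult)
    finally have "norm (norm (a n)) = \<bar>t\<bar> ^ nat \<bar>k\<bar> * (t\<^sup>2) ^ n / (fact n * fact (n + nat \<bar>k\<bar>))"
      by (simp add: a_def)
    also have "\<dots> \<le> \<bar>t\<bar> ^ nat \<bar>k\<bar> * (t\<^sup>2) ^ n / (fact n * 1)"
      by (intro divide_left_mono mult_left_mono) auto
    finally show "norm (norm (a n)) \<le> \<bar>t\<bar> ^ nat \<bar>k\<bar> * (inverse (fact n) * (t\<^sup>2) ^ n)"
      by (simp add: field_simps)
  qed
  then have "(a has_sum suminf a) UNIV"
    using norm_summable_imp_has_sum summable_norm_cancel summable_sums by blast
  then show ?thesis
    by (simp add: a_def [abs_def] bessel_I_def)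
qed

lemma bessel_I_nonneg: "t \<ge> 0 \<Longrightarrow> bessel_I k (2 * t) \<ge> 0"
  by (rule has_sum_nonneg [OF bessel_I_has_sum]) auto

lemma bessel_I_0_ge_1: "t \<ge> 0 \<Longrightarrow> bessel_I 0 (2 * t) \<ge> 1"
  using finite_sum_le_has_sum [OF bessel_I_has_sum [of t 0], of "{0}"] by simp

text \<open>
  Expand \<open>exp (t w)\<close> and \<open>exp (t / w)\<close> and multiply: the terms whose exponents differ by \<open>k\<close> add up to the
  power series of the Bessel function of order \<open>k\<close>.
\<close>
lemma bessel_I_generating_function:
  fixes t :: real and w :: complex
  assumes "w \<noteq> 0"
  shows "((\<lambda>k. of_real (bessel_I k (2 * t)) * w powi k) has_sum exp (t * (w + 1 / w))) UNIV"
proof -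
  define a where "a k n = t ^ (2 * n + nat \<bar>k\<bar>) / (fact n * fact (n + nat \<bar>k\<bar>))" for k :: int and n :: nat
  have "((\<lambda>(i, j). (t * w) ^ i / fact i * ((t / w) ^ j / fact j)) has_sum exp (t * w) * exp (t / w)) (UNIV \<times> UNIV)"
    by (intro has_sum_mult_Times has_sum_exp_series) auto
  also have "exp (t * w) * exp (t / w) = exp (t * (w + 1 / w))"
    by (simp add: exp_add [symmetric] algebra_simps)
  also have "((\<lambda>(i, j). (t * w) ^ i / fact i * ((t / w) ^ j / fact j)) has_sum \<dots>) (UNIV \<times> UNIV)
    \<longleftrightarrow> ((\<lambda>(k, n). of_real (a k n) * w powi k) has_sum \<dots>) (UNIV \<times> UNIV)"
    \<comment> \<open>The pair of exponents is recorded by its difference \<open>k\<close> and its minimum \<open>n\<close>.\<close>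
  proof (rule has_sum_reindex_bij_witness[where i = "\<lambda>(k, n). (n + nat k, n + nat (- k))"
        and j = "\<lambda>(i, j). (int i - int j, min i j)"], goal_cases)
    case (5 p)
    obtain i j where p: "p = (i, j)" by force
    show ?case
    proof (cases "j \<le> i")
      case True
      then obtain k where "i = j + k" using le_Suc_ex by blast
      then show ?thesis using assms
        by (simp add: p a_def power_mult_distrib power_divide power_add mult_2 mult_2_right field_simps)
    next
      case False
      then obtain k where "j = i + k" using le_Suc_ex nat_le_linear by blast
      then show ?thesis using assms
        by (simp add: p a_def power_mult_distrib power_divide power_add mult_2 mult_2_right power_int_minus field_simps)
    qed
  qed auto
  finally have S: "((\<lambda>(k, n). of_real (a k n) * w powi k) has_sum exp (t * (w + 1 / w))) (UNIV \<times> UNIV)" .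
  show ?thesis
  proof (rule has_sum_SigmaD[OF S])
    fix k
    have "(a k has_sum bessel_I k (2 * t)) UNIV"
      unfolding a_def [abs_def] by (rule bessel_I_has_sum)
    then show "((\<lambda>n. (case (k, n) of (k, n) \<Rightarrow> of_real (a k n) * w powi k)) has_sum
        of_real (bessel_I k (2 * t)) * w powi k) UNIV"
      by (auto intro!: has_sum_cmult_left has_sum_of_real)
  qed
qed

definition laplacian_symbol :: "('d::finite \<Rightarrow> complex) \<Rightarrow> real" where
  "laplacian_symbol w = (\<Sum>i\<in>UNIV. (norm (1 - w i))\<^sup>2)"

text \<open>The transition probabilities of the continuous-time simple random walk on \<open>\<int>\<^sup>d\<close> started at \<open>0\<close>; they are the
  weights in the integral that defines the fractional kernel.\<close>
definition heat_kernel :: "real \<Rightarrow> int ^ 'd \<Rightarrow> real" where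
  "heat_kernel t m = exp (- 2 * real CARD('d) * t) * (\<Prod>i\<in>UNIV. bessel_I (m $ i) (2 * t))"

text \<open>Completes the exponent of the generating function to the symbol; this is the trigonometric
  identity \<open>4 sin\<^sup>2(\<theta>/2) = 2 - 2 cos \<theta>\<close>.\<close>
lemma norm_one_minus_unit:
  fixes w :: complex
  assumes "norm w = 1"
  shows "of_real ((norm (1 - w))\<^sup>2) = 2 - (w + 1 / w)"
proof -
  have "w * cnj w = 1" using assms by (simp add: complex_norm_square [symmetric])
  moreover have "1 / w = cnj w" by (simp add: inverse_unit_eq_cnj [OF assms] divide_inverse)
  moreover have "of_real ((norm (1 - w))\<^sup>2) = (1 - w) * cnj (1 - w)"
    by (simp only: complex_norm_square)
  ultimately show ?thesis by (simp add: algebra_simps)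
qed

lemma heat_kernel_fourier:
  fixes w :: "'d::finite \<Rightarrow> complex"
  assumes w: "\<And>i. norm (w i) = 1"
  shows "((\<lambda>m :: int ^ 'd. of_real (heat_kernel t m) * lattice_character w m)
    has_sum of_real (exp (- t * laplacian_symbol w))) UNIV"
proof -
  have w0: "w i \<noteq> 0" for i using w[of i] by auto
  have "((\<lambda>m :: int ^ 'd. \<Prod>i\<in>UNIV. of_real (bessel_I (m $ i) (2 * t)) * w i powi (m $ i)) has_sum
    (\<Prod>i\<in>UNIV. exp (t * (w i + 1 / w i)))) UNIV"
    by (intro has_sum_prod_vec bessel_I_generating_function w0)
  then have "((\<lambda>m :: int ^ 'd. of_real (exp (- 2 * real CARD('d) * t)) *
      (\<Prod>i\<in>UNIV. of_real (bessel_I (m $ i) (2 * t)) * w i powi (m $ i))) has_sum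
    of_real (exp (- 2 * real CARD('d) * t)) * (\<Prod>i\<in>UNIV. exp (t * (w i + 1 / w i)))) UNIV"
    by (rule has_sum_cmult_right)
  also have "of_real (exp (- 2 * real CARD('d) * t)) * (\<Prod>i\<in>UNIV. exp (t * (w i + 1 / w i)))
     = (\<Prod>i\<in>UNIV. exp (- 2 * of_real t) * exp (t * (w i + 1 / w i)))"
    by (simp add: prod.distrib exp_of_real [symmetric] exp_of_nat_mult [symmetric] mult_ac)
  also have "\<dots> = (\<Prod>i\<in>UNIV. exp (- of_real t * of_real ((norm (1 - w i))\<^sup>2)))"
    by (intro prod.cong refl) (simp only: norm_one_minus_unit[OF w] exp_add [symmetric], simp add: algebra_simps)
  also have "\<dots> = of_real (exp (- t * laplacian_symbol w))"
    by (simp add: laplacian_symbol_def exp_sum [symmetric] sum_distrib_left exp_of_real [symmetric] sum_negf)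
  finally show ?thesis
    by (simp add: heat_kernel_def lattice_character_def prod.distrib mult_ac)
qed

lemma heat_kernel_nonneg: "t \<ge> 0 \<Longrightarrow> heat_kernel t m \<ge> 0"
  by (auto simp: heat_kernel_def intro!: mult_nonneg_nonneg prod_nonneg bessel_I_nonneg)

lemma heat_kernel_0_ge:
  assumes "t \<ge> 0"
  shows "heat_kernel t (0 :: int ^ 'd) \<ge> exp (- (t * (2 * real CARD('d))))"
proof -
  have "(\<Prod>i\<in>(UNIV :: 'd set). bessel_I 0 (2 * t)) \<ge> 1"
    by (intro prod_ge_1 bessel_I_0_ge_1 assms)
  then show ?thesis
    unfolding heat_kernel_def by (simp add: mult_ac)
qed

lemma measurable_heat_kernel [measurable]: "(\<lambda>t. heat_kernel t m) \<in> borel_measurable borel"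
  unfolding heat_kernel_def bessel_I_def by measurable

lemma heat_kernel_has_sum_1: "(heat_kernel t has_sum 1) (UNIV :: (int ^ 'd) set)"
  using has_sum_Re [OF heat_kernel_fourier [of "\<lambda>_ :: 'd. 1" t]]
  by (simp add: lattice_character_def laplacian_symbol_def)

lemma heat_kernel_has_sum_1_minus_character:
  fixes w :: "'d::finite \<Rightarrow> complex"
  assumes "\<And>i. norm (w i) = 1"
  shows "((\<lambda>m. heat_kernel t m * (1 - Re (lattice_character w m))) has_sum
    1 - exp (- (t * laplacian_symbol w))) UNIV"
  using has_sum_diff [OF heat_kernel_has_sum_1 [of t] has_sum_Re [OF heat_kernel_fourier [OF assms]]]
  by (simp add: algebra_simps)

text \<open>
  A consequence of conservation of mass. The bound is \<open>O(t)\<close> as \<open>t \<rightarrow> 0\<close>, which is what makes the integral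
  defining the kernel converge at \<open>0\<close>; it has the form that occurs in the subordination integral.
\<close>
lemma heat_kernel_le:
  fixes m :: "int ^ 'd"
  assumes "t \<ge> 0" "m \<noteq> 0"
  shows "heat_kernel t m \<le> 1 - exp (- (t * (2 * real CARD('d))))"
proof -
  have "(\<Sum>k\<in>{0, m}. heat_kernel t k) \<le> 1"
    by (rule finite_sum_le_has_sum [OF heat_kernel_has_sum_1]) (use assms in \<open>auto simp: heat_kernel_nonneg\<close>)
  then show ?thesis
    using assms(2) heat_kernel_0_ge [OF assms(1), where 'd = 'd] by simp
qed

section \<open>Powers as subordination integrals\<close>

text \<open>The integral \<open>\<integral> (1 - e\<^bsup>-t\<mu>\<^esup>) t\<^bsup>-1-s\<^esup> dt\<close> over the positive half line, equal to \<open>\<bar>\<Gamma>(-s)\<bar> \<mu>\<^sup>s\<close> for \<open>0 < s < 1\<close>.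
  It is homogeneous of degree \<open>s\<close> in \<open>\<mu>\<close>, which is how the power \<open>\<lambda>\<^sup>s\<close> arises.\<close>
definition subordination_integral :: "real \<Rightarrow> real \<Rightarrow> ennreal" where
  "subordination_integral s \<mu> =
    (\<integral>\<^sup>+t. ennreal (indicator {0<..} t * ((1 - exp (- (t * \<mu>))) / t powr (1 + s))) \<partial>lborel)"

lemma subordination_integral_scale:
  assumes "\<mu> > 0"
  shows "subordination_integral s \<mu> = ennreal (\<mu> powr s) * subordination_integral s 1"
proof -
  have "subordination_integral s 1 = ennreal \<mu> * (\<integral>\<^sup>+t. ennreal (indicator {0<..} (\<mu> * t) *
      ((1 - exp (- (\<mu> * t * 1))) / (\<mu> * t) powr (1 + s))) \<partial>lborel)"
    unfolding subordination_integral_def using assms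
      nn_integral_real_affine [of "\<lambda>t. ennreal (indicator {0<..} t * ((1 - exp (- (t * 1))) / t powr (1 + s)))" \<mu> 0]
    by simp
  also have "(\<integral>\<^sup>+t. ennreal (indicator {0<..} (\<mu> * t) *
      ((1 - exp (- (\<mu> * t * 1))) / (\<mu> * t) powr (1 + s))) \<partial>lborel) =
    (\<integral>\<^sup>+t. ennreal (1 / \<mu> powr (1 + s)) *
      ennreal (indicator {0<..} t * ((1 - exp (- (t * \<mu>))) / t powr (1 + s))) \<partial>lborel)"
    using assms by (intro nn_integral_cong, subst ennreal_mult [symmetric])
      (auto simp: indicator_def powr_mult zero_less_mult_iff mult_ac)
  also have "\<dots> = ennreal (1 / \<mu> powr (1 + s)) * subordination_integral s \<mu>"
    unfolding subordination_integral_def by (intro nn_integral_cmult) measurable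
  finally have J: "subordination_integral s 1 =
      ennreal \<mu> * (ennreal (1 / \<mu> powr (1 + s)) * subordination_integral s \<mu>)" .
  have "ennreal (\<mu> powr s) * (ennreal \<mu> * ennreal (1 / \<mu> powr (1 + s))) =
      ennreal (\<mu> powr s * (\<mu> * (1 / \<mu> powr (1 + s))))"
    using assms by (simp only: ennreal_mult powr_ge_zero mult_nonneg_nonneg divide_nonneg_nonneg
      less_imp_le zero_le_one)
  also have "\<mu> powr s * (\<mu> * (1 / \<mu> powr (1 + s))) = 1"
    using assms by (simp add: powr_add)
  finally show ?thesis
    by (simp add: J mult.assoc [symmetric])
qed

text \<open>The numerator is at most \<open>t\<close>, which gives integrability at \<open>0\<close> since \<open>s < 1\<close>, and at most \<open>1\<close>, which
  gives integrability at infinity since \<open>s > 0\<close>.\<close>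
lemma subordination_integral_1_finite:
  assumes "0 < s" "s < 1"
  shows "subordination_integral s 1 < \<infinity>"
proof -
  have bound: "indicator {0<..} t * ((1 - exp (- (t * 1))) / t powr (1 + s)) \<le>
    t powr (- s) * indicator {0..1} t + t powr (- 1 - s) * indicator {1..} t" for t :: real
  proof (cases "t > 0")
    case True
    have "1 - exp (- t) \<le> t" using exp_ge_add_one_self [of "- t"] by simp
    then have "(1 - exp (- t)) / t powr (1 + s) \<le> t / t powr (1 + s)"
      using True by (intro divide_right_mono) auto
    also have "\<dots> = t powr (- s)"
      using True by (simp add: powr_add powr_minus_divide)
    finally have "(1 - exp (- t)) / t powr (1 + s) \<le> t powr (- s)" .
    moreover have "(1 - exp (- t)) / t powr (1 + s) \<le> 1 / t powr (1 + s)"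
      by (intro divide_right_mono) auto
    moreover have "1 / t powr (1 + s) = t powr (- 1 - s)"
      by (simp add: powr_minus_divide [symmetric])
    \<comment> \<open>At \<open>t = 1\<close> both terms of the bound are present.\<close>
    moreover have "- 1 \<le> exp (- 1 :: real)"
      by (rule order_trans [of _ 0]) auto
    ultimately show ?thesis using True
      by (cases "t \<le> 1") (auto simp: indicator_def intro: order_trans)
  qed (auto simp: indicator_def)
  have "((\<lambda>t. t powr (- s)) has_integral 1 powr (- s + 1) / (- s + 1)) {0..1}"
    using assms by (intro has_integral_powr_from_0) auto
  from nn_integral_has_integral_lebesgue' [OF _ this]
  have A: "(\<integral>\<^sup>+t. ennreal (t powr (- s)) * indicator {0..1} t \<partial>lborel) < \<infinity>" by simp
  have "((\<lambda>t. t powr (- 1 - s)) has_integral - (1 powr (- 1 - s + 1)) / (- 1 - s + 1)) {1..}"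
    using assms by (intro has_integral_powr_to_inf) auto
  from nn_integral_has_integral_lebesgue' [OF _ this]
  have B: "(\<integral>\<^sup>+t. ennreal (t powr (- 1 - s)) * indicator {1..} t \<partial>lborel) < \<infinity>" by simp
  have "subordination_integral s 1 \<le> (\<integral>\<^sup>+t. ennreal (t powr (- s)) * indicator {0..1} t +
      ennreal (t powr (- 1 - s)) * indicator {1..} t \<partial>lborel)"
    unfolding subordination_integral_def
  proof (intro nn_integral_mono)
    fix t :: real
    have E: "ennreal (t powr (- s)) * indicator {0..1} t + ennreal (t powr (- 1 - s)) * indicator {1..} t
       = ennreal (t powr (- s) * indicator {0..1} t + t powr (- 1 - s) * indicator {1..} t)"
      by (auto simp: indicator_def ennreal_plus)
    show "ennreal (indicator {0<..} t * ((1 - exp (- (t * 1))) / t powr (1 + s)))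
      \<le> ennreal (t powr (- s)) * indicator {0..1} t + ennreal (t powr (- 1 - s)) * indicator {1..} t"
      unfolding E by (intro ennreal_leI bound)
  qed
  also have "\<dots> = (\<integral>\<^sup>+t. ennreal (t powr (- s)) * indicator {0..1} t \<partial>lborel) +
      (\<integral>\<^sup>+t. ennreal (t powr (- 1 - s)) * indicator {1..} t \<partial>lborel)"
    by (intro nn_integral_add) measurable
  also have "\<dots> < \<infinity>" using A B by (simp add: ennreal_add_less_top)
  finally show ?thesis .
qed

lemma subordination_integral_1_pos: "subordination_integral s 1 > 0"
proof -
  have "\<not> (AE t in lborel. ennreal (indicator {0<..} t * ((1 - exp (- (t * 1))) / t powr (1 + s))) = 0)"
  proof
    assume "AE t in lborel. ennreal (indicator {0<..} t * ((1 - exp (- (t * 1))) / t powr (1 + s))) = 0"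
    then have "AE t in lborel. t \<notin> {1..2::real}"
    proof eventually_elim
      case (elim t)
      then show ?case
        by (auto simp: indicator_def ennreal_eq_0_iff divide_le_0_iff)
    qed
    then have "emeasure lborel {1..2::real} = 0"
      by (subst (asm) AE_iff_measurable [where N = "{1..2}"]) auto
    then show False by simp
  qed
  then show ?thesis
    unfolding subordination_integral_def
    by (subst zero_less_iff_neq_zero, subst nn_integral_0_iff_AE) auto
qed

lemma subordination_integral_finite:
  assumes "0 < s" "s < 1" "\<mu> > 0"
  shows "subordination_integral s \<mu> < \<infinity>"
  using subordination_integral_1_finite [OF assms(1,2)] assms(3)
  by (subst subordination_integral_scale) (auto simp: ennreal_mult_less_top)

section \<open>Fourier transform of the fractional kernel\<close>

definition frac_kernel_const :: "real \<Rightarrow> real \<Rightarrow> real" where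
  "frac_kernel_const h s = 1 / (h powr (2 * s) * \<bar>Gamma (- s)\<bar>)"

lemma frac_kernel_const_pos:
  assumes "h > 0" "0 < s" "s < 1"
  shows "frac_kernel_const h s > 0"
proof -
  have "- s \<notin> \<int>\<^sub>\<le>\<^sub>0"
  proof
    assume "- s \<in> \<int>\<^sub>\<le>\<^sub>0"
    then obtain n :: nat where "- s = - real n" by (auto elim: nonpos_Ints_cases')
    then show False using assms by (cases n) auto
  qed
  then have "Gamma (- s) \<noteq> 0" by (rule Gamma_nonzero)
  then show ?thesis using assms by (simp add: frac_kernel_const_def)
qed

context
  fixes h s :: real
  assumes h: "h > 0" and s: "0 < s" "s < 1"
begin

lemma frac_kernel_eq_integral:
  "m \<noteq> 0 \<Longrightarrow> frac_kernel h s m = frac_kernel_const h s *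
    (\<integral>t. indicator {0<..} t * (heat_kernel t m / t powr (1 + s)) \<partial>lborel)"
  by (simp add: frac_kernel_def frac_kernel_const_def heat_kernel_def set_lebesgue_integral_def)

lemma frac_kernel_nonneg: "frac_kernel h s m \<ge> 0"
proof (cases "m = 0")
  case False
  have "(\<integral>t. indicator {0<..} t * (heat_kernel t m / t powr (1 + s)) \<partial>lborel) \<ge> 0"
    by (rule Bochner_Integration.integral_nonneg) (auto simp: indicator_def heat_kernel_nonneg)
  then show ?thesis
    unfolding frac_kernel_eq_integral [OF False]
    using frac_kernel_const_pos [OF h s] by (simp only: mult_nonneg_nonneg less_imp_le)
qed (simp add: frac_kernel_def)

lemma ennreal_frac_kernel:
  fixes m :: "int ^ 'd"
  assumes "m \<noteq> 0"
  shows "ennreal (frac_kernel h s m) = ennreal (frac_kernel_const h s) *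
      (\<integral>\<^sup>+t. ennreal (indicator {0<..} t * (heat_kernel t m / t powr (1 + s))) \<partial>lborel)"
proof -
  let ?f = "\<lambda>t. indicator {0<..} t * (heat_kernel t m / t powr (1 + s))"
  have f_nonneg: "?f t \<ge> 0" for t
    by (auto simp: indicator_def heat_kernel_nonneg)
  have "(\<integral>\<^sup>+t. ennreal (?f t) \<partial>lborel) \<le> subordination_integral s (2 * real CARD('d))"
    unfolding subordination_integral_def using assms
    by (intro nn_integral_mono ennreal_leI)
      (auto simp: indicator_def intro!: divide_right_mono heat_kernel_le)
  also have "\<dots> < \<infinity>"
    by (intro subordination_integral_finite s) auto
  finally have "integrable lborel ?f"
    using f_nonneg by (intro integrableI_nonneg) auto
  then have "(\<integral>\<^sup>+t. ennreal (?f t) \<partial>lborel) = ennreal (\<integral>t. ?f t \<partial>lborel)"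
    using f_nonneg by (intro nn_integral_eq_integral) auto
  then show ?thesis
    unfolding frac_kernel_eq_integral [OF assms]
    using frac_kernel_const_pos [OF h s] by (simp add: ennreal_mult')
qed

text \<open>
  Tonelli's theorem: sums of the kernel against a nonnegative weight reduce to sums of the heat
  kernel. The weight has to vanish at \<open>0\<close>, where the kernel is set to \<open>0\<close> although the integral of
  the heat kernel diverges.
\<close>
lemma nn_integral_frac_kernel:
  fixes g :: "int ^ 'd \<Rightarrow> real"
  assumes g: "\<And>m. g m \<ge> 0" "g 0 = 0"
    and [measurable]: "G \<in> borel_measurable borel"
    and G: "\<And>t. t > 0 \<Longrightarrow> ((\<lambda>m. heat_kernel t m * g m) has_sum G t) UNIV"
  shows "(\<integral>\<^sup>+m. ennreal (frac_kernel h s m * g m) \<partial>count_space UNIV) =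
    ennreal (frac_kernel_const h s) * (\<integral>\<^sup>+t. ennreal (indicator {0<..} t * (G t / t powr (1 + s))) \<partial>lborel)"
proof -
  let ?f = "\<lambda>m t. indicator {0<..} t * (heat_kernel t m / t powr (1 + s))"
  have f_nonneg: "?f m t \<ge> 0" for m t
    by (auto simp: indicator_def heat_kernel_nonneg)
  let ?c = "frac_kernel_const h s"
  have c: "?c > 0" by (rule frac_kernel_const_pos [OF h s])
  have mult3: "ennreal x * ennreal y * ennreal z = ennreal (x * (y * z))"
    if "x \<ge> 0" "y \<ge> 0" "z \<ge> 0" for x y z
    using that by (simp add: ennreal_mult mult.assoc)
  have "ennreal (frac_kernel h s m * g m) = (\<integral>\<^sup>+t. ennreal (?c * (?f m t * g m)) \<partial>lborel)" for m
  proof (cases "m = 0")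
    case False
    have "ennreal (frac_kernel h s m * g m) = ennreal ?c * (\<integral>\<^sup>+t. ennreal (?f m t) \<partial>lborel) * ennreal (g m)"
      using g by (simp add: ennreal_mult' [symmetric] ennreal_mult'' ennreal_frac_kernel [OF False])
    also have "\<dots> = (\<integral>\<^sup>+t. ennreal ?c * ennreal (?f m t) * ennreal (g m) \<partial>lborel)"
      by (simp add: nn_integral_cmult nn_integral_multc)
    also have "\<dots> = (\<integral>\<^sup>+t. ennreal (?c * (?f m t * g m)) \<partial>lborel)"
      by (intro nn_integral_cong mult3 less_imp_le [OF c] f_nonneg g)
    finally show ?thesis .
  qed (use g in simp)
  then have "(\<integral>\<^sup>+m. ennreal (frac_kernel h s m * g m) \<partial>count_space UNIV) =
      (\<integral>\<^sup>+m. (\<integral>\<^sup>+t. ennreal (?c * (?f m t * g m)) \<partial>lborel) \<partial>count_space UNIV)"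
    by simp
  also have "\<dots> = (\<integral>\<^sup>+t. (\<integral>\<^sup>+m. ennreal (?c * (?f m t * g m)) \<partial>count_space UNIV) \<partial>lborel)"
    by (intro nn_integral_count_space_nn_integral [symmetric]) (auto intro: countable_subset)
  also have "\<dots> = (\<integral>\<^sup>+t. ennreal (?c * (indicator {0<..} t * (G t / t powr (1 + s)))) \<partial>lborel)"
  proof (intro nn_integral_cong)
    fix t :: real
    show "(\<integral>\<^sup>+m. ennreal (?c * (?f m t * g m)) \<partial>count_space UNIV) =
        ennreal (?c * (indicator {0<..} t * (G t / t powr (1 + s))))"
    proof (cases "t > 0")
      case True
      have "((\<lambda>m. ?c / t powr (1 + s) * (heat_kernel t m * g m)) has_sum ?c / t powr (1 + s) * G t) UNIV"
        by (intro has_sum_cmult_right G True)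
      then have "((\<lambda>m. ?c * (?f m t * g m)) has_sum ?c * (indicator {0<..} t * (G t / t powr (1 + s)))) UNIV"
        using True by simp
      moreover have "0 \<le> ?c * (?f m t * g m)" for m
        by (rule mult_nonneg_nonneg [OF less_imp_le [OF c] mult_nonneg_nonneg [OF f_nonneg g(1)]])
      moreover from this calculation have "0 \<le> ?c * (indicator {0<..} t * (G t / t powr (1 + s)))"
        using has_sum_nonneg by blast
      ultimately show ?thesis
        by (subst nn_integral_count_space_has_sum_iff)
    qed auto
  qed
  also have "\<dots> = ennreal ?c * (\<integral>\<^sup>+t. ennreal (indicator {0<..} t * (G t / t powr (1 + s))) \<partial>lborel)"
    using c by (subst nn_integral_cmult [symmetric]) (simp_all only: ennreal_mult' less_imp_le, measurable)
  finally show ?thesis .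
qed

text \<open>By conservation of mass the heat kernel off the origin sums to \<open>1 - G\<^sub>t(0)\<close>, so the total mass of the fractional
  kernel is again dominated by a subordination integral.\<close>
lemma frac_kernel_summable: "(frac_kernel h s :: int ^ 'd \<Rightarrow> real) summable_on UNIV"
proof -
  have "((\<lambda>m :: int ^ 'd. heat_kernel t m * of_bool (m \<noteq> 0)) has_sum 1 - heat_kernel t (0 :: int ^ 'd)) UNIV" for t
  proof -
    have "((\<lambda>m :: int ^ 'd. heat_kernel t m * of_bool (m = 0)) has_sum heat_kernel t (0 :: int ^ 'd)) UNIV"
      by (rule has_sum_finite_neutralI [where B = "{0}"]) auto
    from has_sum_diff [OF heat_kernel_has_sum_1 this] show ?thesis
      by (rule has_sum_cong [THEN iffD1, rotated]) auto
  qed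
  then have E: "(\<integral>\<^sup>+m. ennreal (frac_kernel h s m * of_bool (m \<noteq> 0)) \<partial>count_space (UNIV :: (int ^ 'd) set)) =
      ennreal (frac_kernel_const h s) *
      (\<integral>\<^sup>+t. ennreal (indicator {0<..} t * ((1 - heat_kernel t (0 :: int ^ 'd)) / t powr (1 + s))) \<partial>lborel)"
    by (intro nn_integral_frac_kernel) auto
  have "(\<integral>\<^sup>+t. ennreal (indicator {0<..} t * ((1 - heat_kernel t (0 :: int ^ 'd)) / t powr (1 + s))) \<partial>lborel)
      \<le> subordination_integral s (2 * real CARD('d))"
    unfolding subordination_integral_def
    using heat_kernel_0_ge [where 'd = 'd]
    by (intro nn_integral_mono ennreal_leI)
      (auto simp: indicator_def intro!: divide_right_mono)
  also have "\<dots> < \<infinity>"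
    by (intro subordination_integral_finite s) auto
  finally have "(\<integral>\<^sup>+m. ennreal (frac_kernel h s m * of_bool (m \<noteq> 0)) \<partial>count_space (UNIV :: (int ^ 'd) set)) < \<infinity>"
    unfolding E by (simp add: ennreal_mult_less_top)
  moreover have "frac_kernel h s m * of_bool (m \<noteq> 0) = frac_kernel h s m" for m :: "int ^ 'd"
    by (simp add: frac_kernel_def)
  ultimately have fin: "(\<integral>\<^sup>+m. ennreal (frac_kernel h s m) \<partial>count_space (UNIV :: (int ^ 'd) set)) < \<infinity>"
    by simp
  define S where "S = enn2real (\<integral>\<^sup>+m. ennreal (frac_kernel h s m) \<partial>count_space (UNIV :: (int ^ 'd) set))"
  have "(\<integral>\<^sup>+m. ennreal (frac_kernel h s m) \<partial>count_space (UNIV :: (int ^ 'd) set)) = ennreal S"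
    using fin by (simp add: S_def)
  then have "((frac_kernel h s :: int ^ 'd \<Rightarrow> real) has_sum S) UNIV"
    by (subst (asm) nn_integral_count_space_has_sum_iff) (simp_all add: frac_kernel_nonneg S_def)
  then show ?thesis by (rule has_sum_imp_summable)
qed

text \<open>Real parts come first because \<open>1 - Re \<chi>\<close> is nonnegative, as Tonelli's theorem requires; the
  imaginary parts cancel by symmetry of the kernel.\<close>
lemma frac_kernel_fourier_Re:
  fixes w :: "'d::finite \<Rightarrow> complex"
  assumes w: "\<And>i. norm (w i) = 1" and pos: "laplacian_symbol w > 0"
  shows "((\<lambda>m. frac_kernel h s m * (1 - Re (lattice_character w m))) has_sum
    frac_kernel_const h s * enn2real (subordination_integral s 1) * laplacian_symbol w powr s) UNIV"
proof -
  have g: "1 - Re (lattice_character w m) \<ge> 0" for m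
    using complex_Re_le_cmod [of "lattice_character w m"] norm_lattice_character [of w, OF w] by simp
  have "(\<integral>\<^sup>+m. ennreal (frac_kernel h s m * (1 - Re (lattice_character w m))) \<partial>count_space UNIV) =
      ennreal (frac_kernel_const h s) * subordination_integral s (laplacian_symbol w)"
    unfolding subordination_integral_def
    by (intro nn_integral_frac_kernel heat_kernel_has_sum_1_minus_character w g)
      (simp_all add: lattice_character_def)
  also have "\<dots> = ennreal (frac_kernel_const h s) *
      (ennreal (laplacian_symbol w powr s) * ennreal (enn2real (subordination_integral s 1)))"
    using subordination_integral_1_finite [OF s] by (subst subordination_integral_scale [OF pos]) simp
  also have "\<dots> = ennreal (frac_kernel_const h s * enn2real (subordination_integral s 1) * laplacian_symbol w powr s)"
    using frac_kernel_const_pos [OF h s] by (simp add: ennreal_mult mult_ac)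
  finally show ?thesis
    using frac_kernel_const_pos [OF h s]
    by (subst (asm) nn_integral_count_space_has_sum_iff) (simp_all only: frac_kernel_nonneg g
      mult_nonneg_nonneg less_imp_le enn2real_nonneg powr_ge_zero)
qed

end

lemma frac_kernel_uminus: "frac_kernel h s (- m) = frac_kernel h s m"
  by (simp add: frac_kernel_def bessel_I_def)

lemma frac_kernel_fourier:
  assumes h: "h > 0" and s: "0 < s" "s < 1"
  obtains C where "C > 0" "\<And>w :: 'd::finite \<Rightarrow> complex. (\<And>i. norm (w i) = 1) \<Longrightarrow> laplacian_symbol w > 0 \<Longrightarrow>
    ((\<lambda>m. of_real (frac_kernel h s m) * (1 - lattice_character w m)) has_sum
      of_real (C * laplacian_symbol w powr s)) UNIV"
proof
  let ?C = "frac_kernel_const h s * enn2real (subordination_integral s 1)"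
  show "?C > 0"
    using frac_kernel_const_pos [OF h s] subordination_integral_1_pos subordination_integral_1_finite [OF s]
    by (simp add: enn2real_positive_iff)
  fix w :: "'d::finite \<Rightarrow> complex"
  assume w: "\<And>i. norm (w i) = 1" and pos: "laplacian_symbol w > 0"
  have "(\<lambda>m. norm (complex_of_real (frac_kernel h s m) * (1 - lattice_character w m))) summable_on UNIV"
  proof (rule summable_on_comparison_test)
    show "(\<lambda>m :: int ^ 'd. 2 * frac_kernel h s m) summable_on UNIV"
      by (intro summable_on_cmult_right frac_kernel_summable h s)
    fix m :: "int ^ 'd"
    have "norm (1 - lattice_character w m) \<le> 2"
      using norm_triangle_ineq4 [of 1 "lattice_character w m"] norm_lattice_character [of w, OF w] by simp
    then have "frac_kernel h s m * norm (1 - lattice_character w m) \<le> frac_kernel h s m * 2"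
      by (intro mult_left_mono frac_kernel_nonneg h s)
    then show "norm (complex_of_real (frac_kernel h s m) * (1 - lattice_character w m)) \<le> 2 * frac_kernel h s m"
      using frac_kernel_nonneg [OF h s, of m] by (simp add: norm_mult)
  qed auto
  from abs_summable_summable [OF this] obtain S where S: "((\<lambda>m. complex_of_real (frac_kernel h s m) * (1 - lattice_character w m)) has_sum S) UNIV"
    unfolding summable_on_def by blast
  have "Re S = ?C * laplacian_symbol w powr s"
    using has_sum_Re [OF S] frac_kernel_fourier_Re [OF h s w pos] by (auto intro: has_sum_unique)
  moreover have "Im S = 0"
  proof -
    have "((\<lambda>m. cnj (complex_of_real (frac_kernel h s m) * (1 - lattice_character w m))) has_sum cnj S) UNIV"
      by (subst has_sum_cnj_iff) (rule S)
    also have "?this \<longleftrightarrow> ((\<lambda>m. complex_of_real (frac_kernel h s m) * (1 - lattice_character w m)) has_sum cnj S) UNIV"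
      by (rule has_sum_reindex_bij_witness [where i = uminus and j = uminus])
        (auto simp: frac_kernel_uminus lattice_character_uminus [OF w])
    finally have "S = cnj S" using S has_sum_unique by blast
    then show ?thesis by (simp add: complex_eq_iff)
  qed
  ultimately have "S = of_real (?C * laplacian_symbol w powr s)"
    by (simp add: complex_eq_iff)
  with S show "((\<lambda>m. complex_of_real (frac_kernel h s m) * (1 - lattice_character w m)) has_sum
      of_real (?C * laplacian_symbol w powr s)) UNIV" by simp
qed

section \<open>The Fourier transform of the fractional Laplacian\<close>

text \<open>Since the kernel is summable with sum \<open>\<kappa>\<close>, the operator is \<open>\<kappa>\<close> times the identity minus a convolution, and
  the convolution with a finitely supported function is a finite sum.\<close>
lemma frac_laplacian_eq:
  fixes u :: "int ^ 'd \<Rightarrow> real"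
  assumes \<kappa>: "(frac_kernel h s has_sum \<kappa>) (UNIV :: (int ^ 'd) set)"
    and B: "finite B" "\<And>j. j \<notin> B \<Longrightarrow> u j = 0"
  shows "frac_laplacian h s u j = \<kappa> * u j - (\<Sum>m\<in>B. u m * frac_kernel h s (j - m))"
proof -
  have "((\<lambda>m. frac_kernel h s (j - m)) has_sum \<kappa>) UNIV \<longleftrightarrow> (frac_kernel h s has_sum \<kappa>) (UNIV :: (int ^ 'd) set)"
    by (rule has_sum_reindex_bij_witness [where i = "\<lambda>n. j - n" and j = "\<lambda>m. j - m"]) auto
  then have "((\<lambda>m. u j * frac_kernel h s (j - m)) has_sum u j * \<kappa>) UNIV"
    using \<kappa> by (intro has_sum_cmult_right) simp
  moreover have "((\<lambda>m. u m * frac_kernel h s (j - m)) has_sum (\<Sum>m\<in>B. u m * frac_kernel h s (j - m))) UNIV"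
    using B by (intro has_sum_finite_neutralI) auto
  ultimately have "((\<lambda>m. u j * frac_kernel h s (j - m) - u m * frac_kernel h s (j - m)) has_sum
      u j * \<kappa> - (\<Sum>m\<in>B. u m * frac_kernel h s (j - m))) UNIV"
    by (rule has_sum_diff)
  then have "((\<lambda>m. (u j - u m) * frac_kernel h s (j - m)) has_sum
      u j * \<kappa> - (\<Sum>m\<in>B. u m * frac_kernel h s (j - m))) (UNIV - {j})"
    by (rule has_sum_cong_neutral [THEN iffD1, rotated -1]) (auto simp: algebra_simps)
  then show ?thesis
    unfolding frac_laplacian_def by (simp add: infsumI mult_ac)
qed

text \<open>
  By the convolution theorem the multiplier is \<open>\<kappa>\<close> minus the transform of the kernel, that is, the sum
  of the kernel against \<open>1 - \<chi>\<close>.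
\<close>
lemma frac_laplacian_fourier:
  fixes u :: "int ^ 'd \<Rightarrow> real" and w :: "'d \<Rightarrow> complex"
  assumes h: "h > 0" and s: "0 < s" "s < 1"
    and B: "finite B" "\<And>j. j \<notin> B \<Longrightarrow> u j = 0" "\<And>j. j \<notin> B \<Longrightarrow> frac_laplacian h s u j = 0"
    and w: "\<And>i. norm (w i) = 1"
    and S: "((\<lambda>m. of_real (frac_kernel h s m) * (1 - lattice_character w m)) has_sum S) UNIV"
  shows "(\<Sum>j\<in>B. of_real (frac_laplacian h s u j) * lattice_character w j) =
    S * (\<Sum>j\<in>B. of_real (u j) * lattice_character w j)"
proof -
  obtain \<kappa> where \<kappa>: "(frac_kernel h s has_sum \<kappa>) (UNIV :: (int ^ 'd) set)"
    using frac_kernel_summable [OF h s] by (auto simp: summable_on_def)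
  have "((\<lambda>m. of_real (frac_kernel h s m) - of_real (frac_kernel h s m) * (1 - lattice_character w m))
      has_sum of_real \<kappa> - S) UNIV"
    by (intro has_sum_diff has_sum_of_real \<kappa> S)
  then have Khat: "((\<lambda>m. of_real (frac_kernel h s m) * lattice_character w m) has_sum of_real \<kappa> - S) UNIV"
    by (simp add: algebra_simps)
  have K: "((\<lambda>j. of_real (frac_kernel h s (j - m)) * lattice_character w j) has_sum
      (of_real \<kappa> - S) * lattice_character w m) UNIV" for m
  proof -
    have "((\<lambda>n. of_real (frac_kernel h s n) * lattice_character w n * lattice_character w m) has_sum
      (of_real \<kappa> - S) * lattice_character w m) UNIV"
      by (intro has_sum_cmult_left Khat)
    also have "?this \<longleftrightarrow> ?thesis"
      by (rule has_sum_reindex_bij_witness [where i = "\<lambda>j. j - m" and j = "\<lambda>n. n + m"])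
        (auto simp: lattice_character_add [of w, OF w])
    finally show ?thesis .
  qed
  let ?U = "\<Sum>j\<in>B. of_real (u j) * lattice_character w j"
  have "((\<lambda>j. of_real \<kappa> * (of_real (u j) * lattice_character w j) -
      (\<Sum>m\<in>B. of_real (u m) * (of_real (frac_kernel h s (j - m)) * lattice_character w j))) has_sum
      of_real \<kappa> * ?U - (\<Sum>m\<in>B. of_real (u m) * ((of_real \<kappa> - S) * lattice_character w m))) UNIV"
    using B by (intro has_sum_diff has_sum_sum has_sum_cmult_right K has_sum_finite_neutralI) auto
  also have "of_real \<kappa> * ?U - (\<Sum>m\<in>B. of_real (u m) * ((of_real \<kappa> - S) * lattice_character w m)) = S * ?U"
    by (simp add: sum_distrib_left algebra_simps sum_subtractf)
  also have "(\<lambda>j. of_real \<kappa> * (of_real (u j) * lattice_character w j) -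
      (\<Sum>m\<in>B. of_real (u m) * (of_real (frac_kernel h s (j - m)) * lattice_character w j))) =
      (\<lambda>j. of_real (frac_laplacian h s u j) * lattice_character w j)"
    by (simp add: frac_laplacian_eq [OF \<kappa> B(1,2)] sum_distrib_left algebra_simps)
  finally have "((\<lambda>j. of_real (frac_laplacian h s u j) * lattice_character w j) has_sum S * ?U) UNIV" .
  moreover have "((\<lambda>j. of_real (frac_laplacian h s u j) * lattice_character w j) has_sum
      (\<Sum>j\<in>B. of_real (frac_laplacian h s u j) * lattice_character w j)) UNIV"
    using B by (intro has_sum_finite_neutralI) auto
  ultimately show ?thesis by (rule has_sum_unique [symmetric])
qed

section \<open>Restriction to a curve and the conclusion\<close>

lemma finite_lattice_ball:
  assumes "h > 0"
  shows "finite (lattice_ball h R :: (int ^ 'd) set)"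
proof -
  define N where "N = \<lceil>R / h\<rceil>"
  have "lattice_ball h R \<subseteq> vec_lambda ` (UNIV \<rightarrow>\<^sub>E {- N..N} :: ('d \<Rightarrow> int) set)"
  proof
    fix j :: "int ^ 'd" assume "j \<in> lattice_ball h R"
    then have R: "norm (lattice_pt h j) < R" by (simp add: lattice_ball_def)
    have "j $ i \<in> {- N..N}" for i
    proof -
      have "\<bar>h * real_of_int (j $ i)\<bar> < R"
        using component_le_norm_cart [of "lattice_pt h j" i] R by (simp add: lattice_pt_def)
      then have "\<bar>real_of_int (j $ i)\<bar> < R / h"
        using assms by (simp add: abs_mult field_simps)
      then show ?thesis
        unfolding N_def by (simp add: abs_less_iff) linarith
    qed
    then show "j \<in> vec_lambda ` (UNIV \<rightarrow>\<^sub>E {- N..N})"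
      by (intro image_eqI [of _ _ "vec_nth j"]) auto
  qed
  then show ?thesis by (rule finite_subset) (simp add: finite_PiE)
qed

text \<open>
  With \<open>a\<^sub>i = n\<^bsup>idx i\<^esup>\<close> for an injective numbering \<open>idx\<close> of the coordinates, two lattice points have the same
  image only if \<open>n\<close> is a root of the nonzero polynomial whose coefficients are the entries of their
  difference. Finitely many points exclude only finitely many \<open>n\<close>.
\<close>
lemma ex_separating_direction:
  fixes B :: "(int ^ 'd) set"
  assumes "finite B"
  obtains a :: "'d \<Rightarrow> nat" where "\<And>i. a i > 0" "inj_on (\<lambda>j. \<Sum>i\<in>UNIV. int (a i) * j $ i) B"
proof -
  obtain idx :: "'d \<Rightarrow> nat" where idx: "inj idx"
    using finite_imp_inj_to_nat_seg [of "UNIV :: 'd set"] by auto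
  define p where "p d = (\<Sum>i\<in>UNIV. monom (d $ i) (idx i))" for d :: "int ^ 'd"
  have poly_p: "poly (p d) x = (\<Sum>i\<in>UNIV. x ^ idx i * d $ i)" for d x
    by (simp add: p_def poly_sum poly_monom mult_ac)
  have p_ne: "p d \<noteq> 0" if "d \<noteq> 0" for d
  proof -
    obtain i where i: "d $ i \<noteq> 0" using \<open>d \<noteq> 0\<close> by (metis vec_eq_iff zero_index)
    have "coeff (p d) (idx i) = (\<Sum>k\<in>UNIV. if k = i then d $ k else 0)"
      unfolding p_def coeff_sum by (intro sum.cong) (auto simp: injD [OF idx])
    with i show ?thesis by auto
  qed
  define D where "D = (\<lambda>(j, k). j - k) ` (B \<times> B) - {0}"
  have "finite (\<Union>d\<in>D. {x. poly (p d) x = 0})"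
    using assms by (auto simp: D_def intro!: poly_roots_finite p_ne)
  then have "finite (insert 0 (int -` (\<Union>d\<in>D. {x. poly (p d) x = 0})))"
    by (intro finite.insertI finite_vimageI inj_of_nat)
  then obtain n where "n \<notin> insert 0 (int -` (\<Union>d\<in>D. {x. poly (p d) x = 0}))"
    using ex_new_if_finite [OF infinite_UNIV_nat] by blast
  then have n: "n > 0" "\<And>d. d \<in> D \<Longrightarrow> poly (p d) (int n) \<noteq> 0" by auto
  show thesis
  proof (rule that)
    show "n ^ idx i > 0" for i using n by simp
    show "inj_on (\<lambda>j. \<Sum>i\<in>UNIV. int (n ^ idx i) * j $ i) B"
    proof (rule inj_onI)
      fix j k assume jk: "j \<in> B" "k \<in> B"
        "(\<Sum>i\<in>UNIV. int (n ^ idx i) * j $ i) = (\<Sum>i\<in>UNIV. int (n ^ idx i) * k $ i)"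
      then have "poly (p (j - k)) (int n) = 0"
        by (simp add: poly_p algebra_simps sum_subtractf)
      with n(2) have "j - k \<notin> D" by blast
      with jk show "j = k" by (force simp: D_def)
    qed
  qed
qed

lemma power_int_sum:
  fixes z :: "'b::field"
  assumes "z \<noteq> 0"
  shows "z powi (\<Sum>i\<in>A. f i) = (\<Prod>i\<in>A. z powi f i)"
  using assms by (induction A rule: infinite_finite_induct) (auto simp: power_int_add)

lemma coeff_sum_monom:
  fixes c :: "'a \<Rightarrow> 'b::comm_monoid_add"
  assumes "finite B" "inj_on e B" "j \<in> B"
  shows "coeff (\<Sum>k\<in>B. monom (c k) (e k)) (e j) = c j"
proof -
  have "coeff (\<Sum>k\<in>B. monom (c k) (e k)) (e j) = (\<Sum>k\<in>B. if k = j then c k else 0)"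
    unfolding coeff_sum using assms by (intro sum.cong) (auto dest: inj_onD)
  then show ?thesis using assms by simp
qed

theorem theorem3:
  fixes h r s R :: real and u :: "int ^ 'd \<Rightarrow> real"
  assumes "h > 0"
    and "u \<in> Hr_space h r"
    and "0 < s" and "s < 1"
    and "R \<ge> h"
    and "\<And>j. j \<notin> lattice_ball h R \<Longrightarrow> u j = 0"
    and "\<And>j. j \<notin> lattice_ball h R \<Longrightarrow> frac_laplacian h s u j = 0"
  shows "\<forall>j. u j = 0"
proof (rule ccontr)
  assume "\<not> (\<forall>j. u j = 0)"
  then obtain j0 where j0: "u j0 \<noteq> 0" by blast
  define B where "B = (lattice_ball h R :: (int ^ 'd) set)"
  have B: "finite B" "\<And>j. j \<notin> B \<Longrightarrow> u j = 0" "\<And>j. j \<notin> B \<Longrightarrow> frac_laplacian h s u j = 0"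
    using assms by (auto simp: B_def finite_lattice_ball)
  obtain a :: "'d \<Rightarrow> nat" where a: "\<And>i. a i > 0"
    and inj: "inj_on (\<lambda>j :: int ^ 'd. \<Sum>i\<in>UNIV. int (a i) * j $ i) B"
    using ex_separating_direction [OF B(1)] by blast
  define \<pi> where "\<pi> j = (\<Sum>i\<in>UNIV. int (a i) * j $ i)" for j :: "int ^ 'd"
  \<comment> \<open>A shift that clears the negative exponents of the Laurent polynomials.\<close>
  obtain N :: nat where N: "\<And>j. j \<in> B \<Longrightarrow> \<pi> j + int N \<ge> 0"
  proof
    fix j assume "j \<in> B"
    then have "nat (- \<pi> j) \<le> (\<Sum>j\<in>B. nat (- \<pi> j))"
      using B(1) by (intro member_le_sum) auto
    then show "\<pi> j + int (\<Sum>j\<in>B. nat (- \<pi> j)) \<ge> 0" by linarith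
  qed
  define e where "e j = nat (\<pi> j + int N)" for j
  have e: "inj_on e B"
  proof (rule inj_onI)
    fix j k assume "j \<in> B" "k \<in> B" "e j = e k"
    then have "\<pi> j = \<pi> k" using N [of j] N [of k] by (simp add: e_def)
    with inj \<open>j \<in> B\<close> \<open>k \<in> B\<close> show "j = k" by (simp add: \<pi>_def inj_on_def)
  qed
  define poly_of :: "(int ^ 'd \<Rightarrow> real) \<Rightarrow> complex poly" where
    "poly_of v = (\<Sum>j\<in>B. monom (of_real (v j)) (e j))" for v
  have poly_of: "poly (poly_of v) z = z ^ N * (\<Sum>j\<in>B. of_real (v j) * lattice_character (\<lambda>i. z ^ a i) j)"
    if "z \<noteq> 0" for v z
  proof -
    have "z ^ e j = z ^ N * lattice_character (\<lambda>i. z ^ a i) j" if "j \<in> B" for j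
    proof -
      have "lattice_character (\<lambda>i. z ^ a i) j = z powi \<pi> j"
        unfolding lattice_character_def \<pi>_def power_int_power
        by (rule power_int_sum [symmetric]) (use \<open>z \<noteq> 0\<close> in auto)
      moreover have "z ^ e j = z powi (\<pi> j + int N)"
        using N [OF that] by (simp add: e_def power_int_nonneg_exp)
      ultimately show ?thesis using \<open>z \<noteq> 0\<close> by (simp add: power_int_add)
    qed
    then show ?thesis
      by (simp add: poly_of_def poly_sum poly_monom sum_distrib_left mult_ac)
  qed
  \<comment> \<open>The factor left after dividing each \<open>1 - z ^ a i\<close> by \<open>1 - z\<close>.\<close>
  define L where "L z = (\<Sum>i\<in>UNIV. (norm (\<Sum>k<a i. z ^ k))\<^sup>2)" for z :: complex
  have symbol: "laplacian_symbol (\<lambda>i. z ^ a i) = (norm (z - 1))\<^sup>2 * L z" for z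
  proof -
    have "(norm (1 - z ^ a i))\<^sup>2 = (norm (z - 1))\<^sup>2 * (norm (\<Sum>k<a i. z ^ k))\<^sup>2" for i
      by (subst norm_minus_commute)
        (simp add: power_diff_1_eq norm_mult power_mult_distrib)
    then show ?thesis by (simp add: laplacian_symbol_def L_def sum_distrib_left)
  qed
  obtain C where C: "C > 0" and fourier: "\<And>w :: 'd \<Rightarrow> complex. (\<And>i. norm (w i) = 1) \<Longrightarrow> laplacian_symbol w > 0 \<Longrightarrow>
    ((\<lambda>m. of_real (frac_kernel h s m) * (1 - lattice_character w m)) has_sum
      of_real (C * laplacian_symbol w powr s)) UNIV"
    using frac_kernel_fourier [OF assms(1,3,4)] by blast
  show False
  proof (rule fractional_power_not_rational [of s "poly_of u" C L "poly_of (frac_laplacian h s u)"])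
    have "coeff (poly_of u) (e j0) = of_real (u j0)"
      unfolding poly_of_def using B e j0 by (intro coeff_sum_monom) auto
    then show "poly_of u \<noteq> 0" using j0 by auto
    show "isCont L 1" unfolding L_def by (intro continuous_intros)
    have "L 1 = (\<Sum>i\<in>(UNIV :: 'd set). (real (a i))\<^sup>2)" by (simp add: L_def)
    also have "\<dots> > 0" using a by (intro sum_pos) auto
    finally show "L 1 > 0" .
    fix z :: complex assume z: "norm z = 1" "z \<noteq> 1" "L z > 0"
    have w: "norm (z ^ a i) = 1" for i using z by (simp add: norm_power)
    have "laplacian_symbol (\<lambda>i. z ^ a i) > 0" using z by (simp add: symbol)
    with fourier [of "\<lambda>i. z ^ a i"] w have "((\<lambda>m. of_real (frac_kernel h s m) * (1 - lattice_character (\<lambda>i. z ^ a i) m)) has_sum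
      of_real (C * ((norm (z - 1))\<^sup>2 * L z) powr s)) UNIV" by (simp add: symbol)
    from frac_laplacian_fourier [OF assms(1,3,4) B w this] z
    show "poly (poly_of (frac_laplacian h s u)) z = of_real (C * ((norm (z - 1))\<^sup>2 * L z) powr s) * poly (poly_of u) z"
      by (subst (1 2) poly_of) auto
  qed (use assms C in auto)
qed

end
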